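(* Let $m\in\mathbb N$, $a_i\in\mathbb N$ and $b_i\in\mathbb R$ with $b_i>0$ for $1\le i\le m$, and let $n\in\mathbb N$. Then $$\sum S_{a_m,\ldots,a_1}(\pm b_m,\ldots,\pm b_1;2n)=\frac{1}{2^{\sum_{i=1}^m a_i-m}}\,S_{a_m,\ldots,a_1}(b_m^2,\ldots,b_1^2;n),$$ where the sum on the left hand side runs over all $2^m$ possible choices of the signs $\pm$.
   Context: $\mathbb N=\{1,2,\dots\}$. For $c_i\in\mathbb N$, $x_i\in\mathbb R\setminus\{0\}$ the generalized harmonic sum ($S$-sum) is $$S_{c_1,\ldots,c_k}(x_1,\ldots,x_k;n)=\sum_{i_1=1}^n\frac{x_1^{i_1}}{i_1^{c_1}}\sum_{i_2=1}^{i_1}\frac{x_2^{i_2}}{i_2^{c_2}}\cdots\sum_{i_k=1}^{i_{k-1}}\frac{x_k^{i_k}}{i_k^{c_k}}.$$ *)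

theory Defs
  imports Complex_Main "HOL-Library.FuncSet"
begin

text \<open>
  \<open>S_sum [c\<^sub>1, \<dots>, c\<^sub>k] [x\<^sub>1, \<dots>, x\<^sub>k] n\<close> is the generalized harmonic sum, outermost index first.
  The empty sum is 1, so that the innermost summand is \<open>x\<^sub>k ^ i / i ^ c\<^sub>k\<close>.
  Lists of different lengths are not meaningful and are left unspecified.
\<close>

fun S_sum :: "nat list \<Rightarrow> real list \<Rightarrow> nat \<Rightarrow> real" where
  "S_sum [] [] n = 1"
| "S_sum (c # cs) (x # xs) n = (\<Sum>i=1..n. x ^ i / real i ^ c * S_sum cs xs i)"

text \<open>\<open>desc m f = [f m, f (m - 1), \<dots>, f 1]\<close>\<close>

definition desc :: "nat \<Rightarrow> (nat \<Rightarrow> 'a) \<Rightarrow> 'a list" where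
  "desc m f = map f (rev [1..<Suc m])"

end

theory Submission
  imports Defs
begin

text \<open>Summing over the sign of the outermost variable \<open>b\<close> replaces
  \<open>b ^ i\<close> by \<open>b ^ i + (- b) ^ i\<close>, which is 0 for odd \<open>i\<close> and
  \<open>2 * b ^ i\<close> for even \<open>i\<close>. So only the indices \<open>i = 2 * j\<close>
  with \<open>j\<close> up to \<open>n\<close> survive, and each gives \<open>2 / 2 ^ a\<close>
  times the summand \<open>(b^2) ^ j / j ^ a\<close>. The inner sums then have upper limit
  \<open>2 * j\<close>, which is again even, so induction on the depth applies; the factors
  \<open>2 / 2 ^ a\<close> multiply up to the constant. \<open>sum_signs_S_sum_Suc\<close> splits
  off the outermost sign, \<open>sum_double_eq_sum_even\<close> discards the odd indices.\<close>

lemma desc_Suc: "desc (Suc m) f = f (Suc m) # desc m f"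
  by (simp add: desc_def)

lemma desc_cong: "(\<And>i. 1 \<le> i \<Longrightarrow> i \<le> m \<Longrightarrow> f i = g i) \<Longrightarrow> desc m f = desc m g"
  by (auto simp: desc_def)

text \<open>Since \<open>x\<close> lies outside \<open>A\<close>, the map from \<open>(y, s)\<close>
  to \<open>s(x := y)\<close> is injective. Used to separate the outermost sign from the inner
  ones.\<close>

lemma sum_PiE_insert:
  assumes "x \<notin> A"
  shows "(\<Sum>s \<in> Pi\<^sub>E (insert x A) B. h s) = (\<Sum>y \<in> B x. \<Sum>s \<in> Pi\<^sub>E A B. h (s(x := y)))"
proof -
  have "(\<Sum>s \<in> Pi\<^sub>E (insert x A) B. h s) = (\<Sum>(y, s) \<in> B x \<times> Pi\<^sub>E A B. h (s(x := y)))"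
    using sum.reindex[OF inj_combinator[OF assms, of B], of h]
    by (simp add: PiE_insert_eq case_prod_unfold o_def)
  then show ?thesis
    by (simp add: sum.cartesian_product)
qed

lemma sum_double_eq_sum_even:
  fixes f :: "nat \<Rightarrow> 'a::comm_monoid_add"
  assumes "\<And>i. odd i \<Longrightarrow> f i = 0"
  shows "(\<Sum>i=1..2 * n. f i) = (\<Sum>j=1..n. f (2 * j))"
  using assms by (induction n) auto

text \<open>The outermost factor depends only on the sign at \<open>Suc m\<close> and the inner sum
  only on the other signs, so the sum over all signs factors for each fixed
  \<open>i\<close>.\<close>

lemma sum_signs_S_sum_Suc:
  fixes b :: "nat \<Rightarrow> real"
  shows "(\<Sum>s \<in> {1..Suc m} \<rightarrow>\<^sub>E {1, - 1 :: real}.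
            S_sum (desc (Suc m) a) (desc (Suc m) (\<lambda>i. s i * b i)) N)
    = (\<Sum>i=1..N. (b (Suc m) ^ i + (- b (Suc m)) ^ i) / real i ^ a (Suc m) *
        (\<Sum>s \<in> {1..m} \<rightarrow>\<^sub>E {1, - 1}. S_sum (desc m a) (desc m (\<lambda>i. s i * b i)) i))"
proof -
  let ?P = "{1..m} \<rightarrow>\<^sub>E {1, - 1 :: real}"
  let ?S = "\<lambda>s i. S_sum (desc m a) (desc m (\<lambda>i. s i * b i)) i"
  let ?t = "\<lambda>y i. (y * b (Suc m)) ^ i / real i ^ a (Suc m)"
  have ins: "{1..Suc m} = insert (Suc m) {1..m}"
    by auto
  \<comment> \<open>\<open>desc m\<close> reads only the indices 1 to \<open>m\<close>, so the inner
    sums do not see the sign at \<open>Suc m\<close>.\<close>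
  have upd: "desc m (\<lambda>i. (s(Suc m := y)) i * b i) = desc m (\<lambda>i. s i * b i)" for s y
    by (rule desc_cong) auto
  have "(\<Sum>s \<in> {1..Suc m} \<rightarrow>\<^sub>E {1, - 1 :: real}.
            S_sum (desc (Suc m) a) (desc (Suc m) (\<lambda>i. s i * b i)) N)
      = (\<Sum>y \<in> {1, - 1}. \<Sum>s \<in> ?P. \<Sum>i=1..N. ?t y i * ?S s i)"
    unfolding ins by (subst sum_PiE_insert) (simp_all only: desc_Suc S_sum.simps upd fun_upd_same
        atLeastAtMost_iff Suc_n_not_le_n simp_thms)
  also have "\<dots> = (\<Sum>y \<in> {1, - 1}. \<Sum>i=1..N. ?t y i * (\<Sum>s \<in> ?P. ?S s i))"
    by (simp only: sum_distrib_left sum.swap[of _ ?P])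
  also have "\<dots> = (\<Sum>i=1..N. (b (Suc m) ^ i + (- b (Suc m)) ^ i) / real i ^ a (Suc m) *
      (\<Sum>s \<in> ?P. ?S s i))"
    by (simp add: sum.distrib [symmetric] add_divide_distrib distrib_right)
  finally show ?thesis .
qed

lemma sum_signs_S_sum_double:
  fixes b :: "nat \<Rightarrow> real"
  shows "(\<Sum>s \<in> {1..m} \<rightarrow>\<^sub>E {1, - 1 :: real}. S_sum (desc m a) (desc m (\<lambda>i. s i * b i)) (2 * n))
    = 1 / 2 powi (int (\<Sum>i=1..m. a i) - int m) * S_sum (desc m a) (desc m (\<lambda>i. (b i)\<^sup>2)) n"
\<comment> \<open>\<open>n\<close> must vary: the inner sums are needed at \<open>2 * j\<close> for
  every \<open>j\<close> up to \<open>n\<close>.\<close>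
proof (induction m arbitrary: n)
  case 0
  then show ?case by (simp add: desc_def)
next
  case (Suc m)
  let ?T = "\<lambda>i. \<Sum>s \<in> {1..m} \<rightarrow>\<^sub>E {1, - 1}. S_sum (desc m a) (desc m (\<lambda>i. s i * b i)) i"
  let ?c = "\<lambda>m. 1 / 2 powi (int (\<Sum>i=1..m. a i) - int m) :: real"
  let ?S = "S_sum (desc m a) (desc m (\<lambda>i. (b i)\<^sup>2))"
  \<comment> \<open>The exponent is a difference of integers, hence never truncated; one more level
    raises it by \<open>a (Suc m) - 1\<close>, taken in the integers.\<close>
  have c: "?c (Suc m) = 2 / 2 ^ a (Suc m) * ?c m"
    by (simp add: power_int_diff power_int_add field_simps)
  have "(\<Sum>s \<in> {1..Suc m} \<rightarrow>\<^sub>E {1, - 1 :: real}.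
            S_sum (desc (Suc m) a) (desc (Suc m) (\<lambda>i. s i * b i)) (2 * n))
      = (\<Sum>j=1..n. (b (Suc m) ^ (2 * j) + (- b (Suc m)) ^ (2 * j)) /
          real (2 * j) ^ a (Suc m) * ?T (2 * j))"
    \<comment> \<open>For odd \<open>i\<close> the two signs cancel.\<close>
    unfolding sum_signs_S_sum_Suc by (rule sum_double_eq_sum_even) simp
  \<comment> \<open>The induction hypothesis is used at \<open>j\<close> in place of
    \<open>n\<close>; the 2 in \<open>?c (Suc m)\<close> comes from the two equal even powers, the
    \<open>2 ^ a (Suc m)\<close> from the denominator \<open>(2 * j) ^ a (Suc m)\<close>.\<close>
  also have "\<dots> = (\<Sum>j=1..n. ?c (Suc m) * (((b (Suc m))\<^sup>2) ^ j / real j ^ a (Suc m) * ?S j))"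
    unfolding Suc.IH c by (simp add: power_mult power_mult_distrib) (simp add: mult_ac)
  also have "\<dots> = ?c (Suc m) * S_sum (desc (Suc m) a) (desc (Suc m) (\<lambda>i. (b i)\<^sup>2)) n"
    by (simp only: desc_Suc S_sum.simps sum_distrib_left)
  finally show ?case .
qed

theorem theorem9p1:
  fixes m n :: nat and a :: "nat \<Rightarrow> nat" and b :: "nat \<Rightarrow> real"
  assumes "m \<ge> 1" and "n \<ge> 1"
    and "\<And>i. 1 \<le> i \<Longrightarrow> i \<le> m \<Longrightarrow> a i \<ge> 1"
    and "\<And>i. 1 \<le> i \<Longrightarrow> i \<le> m \<Longrightarrow> b i > 0"
  shows "(\<Sum>s \<in> {1..m} \<rightarrow>\<^sub>E {1, - 1 :: real}. S_sum (desc m a) (desc m (\<lambda>i. s i * b i)) (2 * n))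
    = 1 / 2 powi (int (\<Sum>i=1..m. a i) - int m) * S_sum (desc m a) (desc m (\<lambda>i. (b i)\<^sup>2)) n"
  by (rule sum_signs_S_sum_double)

end
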